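(* For all types $t_1, t_2$, if $t_1 \leq t_2$ holds, then $\llbracket t_1\rrbracket \subseteq \llbracket t_2\rrbracket$.
   Context: **Types.** Fix sets of class names $c$ and field names $f$. Types are the finite or infinite terms coinductively defined by $t ::= \mathit{int} \mid \mathit{obj}(c,[f_1{:}t_1,\ldots,f_n{:}t_n]) \mid t_1\vee t_2$. In an object type the fields are finitely many ($n\ge 0$) and distinct, and their order is immaterial. **Values.** Values are the finite or infinite terms coinductively defined by $v ::= i \mid \mathit{obj}(c,[f_1\mapsto v_1,\ldots,f_n\mapsto v_n])$ with $i\in\mathbb{Z}$; fields are again finitely many, distinct, and their order is immaterial. **Derivations.** A derivation is a (possibly infinite) tree whose nodes are pairs (judgment, rule label), such that each node together with its children is a valid instance of the labelled rule. A sub-derivation is a subtree rooted at some node. **Subtyping.** Judgments $t\leq t'$, with rules (all interpreted coinductively): - (int): $\mathit{int}\leq\mathit{int}$ (no premises). - ($\vee$R1): from $t\leq t_1$ infer $t\leq t_1\vee t_2$. - ($\vee$R2): from $t\leq t_2$ infer $t\leq t_1\vee t_2$. - ($\vee$L): from $t_1\leq t$ and $t_2\leq t$ infer $t_1\vee t_2\leq t$. - (obj): from $t_1\leq t'_1,\ldots,t_n\leq t'_n$ infer $\mathit{obj}(c,[f_1{:}t_1,\ldots,f_n{:}t_n,\ldots])\leq\mathit{obj}(c,[f_1{:}t'_1,\ldots,f_n{:}t'_n])$, where the final ellipsis on the left stands for zero or more additional fields. - (distr): from $\mathit{obj}(c,[f{:}u_1,f_1{:}t_1,\ldots,f_n{:}t_n])\leq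 t$ and $\mathit{obj}(c,[f{:}u_2,f_1{:}t_1,\ldots,f_n{:}t_n])\leq t$ infer $\mathit{obj}(c,[f{:}u_1\vee u_2,f_1{:}t_1,\ldots,f_n{:}t_n])\leq t$. A subtyping derivation is contractive iff it contains no sub-derivation built only with rules ($\vee$R1) and ($\vee$R2). The relation $t_1\leq t_2$ holds iff there is a contractive (possibly infinite) derivation for it. **Membership.** Judgments $v\in t$, with rules (interpreted coinductively): - (int): $i\in\mathit{int}$ for $i\in\mathbb{Z}$ (no premises). - ($\vee$L): from $v\in t_1$ infer $v\in t_1\vee t_2$. - ($\vee$R): from $v\in t_2$ infer $v\in t_1\vee t_2$. - (obj): from $v_1\in t_1,\ldots,v_n\in t_n$ infer $\mathit{obj}(c,[f_1\mapsto v_1,\ldots,f_n\mapsto v_n,\ldots])\in\mathit{obj}(c,[f_1{:}t_1,\ldots,f_n{:}t_n])$, where the final ellipsis in the value stands for zero or more additional fields. A membership derivation is contractive iff it contains no sub-derivation built only with membership rules ($\vee$L) and ($\vee$R). The relation $v\in t$ holds iff there is a contractive (possibly infinite) derivation for it. The interpretation of a type is $\llbracket t\rrbracket=\{v\mid v\in t\text{ holds}\}$. *)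

theory Defs
  imports Main "HOL-Library.Finite_Map"
begin

text \<open>The type variables 'c and 'f stand for the sets of class names and field names. A record of
  finitely many distinct, unordered fields is a finite map from field names.\<close>

codatatype ('c, 'f) ty =
    TInt
  | TObj 'c "('f, ('c, 'f) ty) fmap"
  | TOr "('c, 'f) ty" "('c, 'f) ty"

codatatype ('c, 'f) val =
    VInt int
  | VObj 'c "('f, ('c, 'f) val) fmap"

text \<open>Possibly infinite trees with nodes labelled by a judgment and a rule label. The set function
  \<open>labels\<close> collects the rule labels of all nodes of a tree.\<close>

codatatype (judgments: 'j, labels: 'r) deriv =
  Node (concl: 'j) (label: 'r) (children: "('j, 'r) deriv list")

inductive subderiv :: "('j, 'r) deriv \<Rightarrow> ('j, 'r) deriv \<Rightarrow> bool" where
  refl: "subderiv d d"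
| child: "d' \<in> set (children d) \<Longrightarrow> subderiv e d' \<Longrightarrow> subderiv e d"

text \<open>Inference rules are given by a predicate \<open>R r ps j\<close>: judgment \<open>j\<close> follows from the list of
  premises \<open>ps\<close> by a valid instance of the rule labelled \<open>r\<close>.\<close>

definition derivation :: "('r \<Rightarrow> 'j list \<Rightarrow> 'j \<Rightarrow> bool) \<Rightarrow> ('j, 'r) deriv \<Rightarrow> bool" where
  "derivation R d \<longleftrightarrow>
     (\<forall>e. subderiv e d \<longrightarrow> R (label e) (map concl (children e)) (concl e))"

definition contractive :: "'r set \<Rightarrow> ('j, 'r) deriv \<Rightarrow> bool" where
  "contractive L d \<longleftrightarrow> \<not> (\<exists>e. subderiv e d \<and> labels e \<subseteq> L)"

datatype sub_label = SubInt | SubOrR1 | SubOrR2 | SubOrL | SubObj | SubDistr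

text \<open>In \<open>obj\<close>, \<open>fs\<close> enumerates the fields of the right-hand type in an arbitrary order; there is
  one premise for each of them.\<close>

inductive sub_rule ::
  "sub_label \<Rightarrow> (('c, 'f) ty \<times> ('c, 'f) ty) list \<Rightarrow> ('c, 'f) ty \<times> ('c, 'f) ty \<Rightarrow> bool" where
  int: "sub_rule SubInt [] (TInt, TInt)"
| orR1: "sub_rule SubOrR1 [(t, t1)] (t, TOr t1 t2)"
| orR2: "sub_rule SubOrR2 [(t, t2)] (t, TOr t1 t2)"
| orL: "sub_rule SubOrL [(t1, t), (t2, t)] (TOr t1 t2, t)"
| obj: "\<lbrakk>distinct fs; set fs = fmdom' \<sigma>'; fmdom' \<sigma>' \<subseteq> fmdom' \<sigma>\<rbrakk> \<Longrightarrow>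
    sub_rule SubObj (map (\<lambda>f. (the (fmlookup \<sigma> f), the (fmlookup \<sigma>' f))) fs)
      (TObj c \<sigma>, TObj c \<sigma>')"
| distr: "f \<notin> fmdom' \<sigma> \<Longrightarrow>
    sub_rule SubDistr [(TObj c (fmupd f u1 \<sigma>), t), (TObj c (fmupd f u2 \<sigma>), t)]
      (TObj c (fmupd f (TOr u1 u2) \<sigma>), t)"

definition subtype :: "('c, 'f) ty \<Rightarrow> ('c, 'f) ty \<Rightarrow> bool" where
  "subtype t1 t2 \<longleftrightarrow>
     (\<exists>d. derivation sub_rule d \<and> contractive {SubOrR1, SubOrR2} d \<and> concl d = (t1, t2))"

datatype mem_label = MemInt | MemOrL | MemOrR | MemObj

inductive mem_rule ::
  "mem_label \<Rightarrow> (('c, 'f) val \<times> ('c, 'f) ty) list \<Rightarrow> ('c, 'f) val \<times> ('c, 'f) ty \<Rightarrow> bool" where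
  int: "mem_rule MemInt [] (VInt i, TInt)"
| orL: "mem_rule MemOrL [(v, t1)] (v, TOr t1 t2)"
| orR: "mem_rule MemOrR [(v, t2)] (v, TOr t1 t2)"
| obj: "\<lbrakk>distinct fs; set fs = fmdom' \<sigma>; fmdom' \<sigma> \<subseteq> fmdom' \<rho>\<rbrakk> \<Longrightarrow>
    mem_rule MemObj (map (\<lambda>f. (the (fmlookup \<rho> f), the (fmlookup \<sigma> f))) fs)
      (VObj c \<rho>, TObj c \<sigma>)"

definition has_type :: "('c, 'f) val \<Rightarrow> ('c, 'f) ty \<Rightarrow> bool" where
  "has_type v t \<longleftrightarrow>
     (\<exists>d. derivation mem_rule d \<and> contractive {MemOrL, MemOrR} d \<and> concl d = (v, t))"

definition interp :: "('c, 'f) ty \<Rightarrow> ('c, 'f) val set" where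
  "interp t = {v. has_type v t}"

end

theory Submission
  imports Defs
begin

text \<open>Read the membership derivation of \<open>v \<in> t1\<close> alongside the subtyping derivation of
  \<open>t1 \<le> t2\<close> and keep only the branches of \<open>\<or>L\<close> and \<open>distr\<close> that the membership derivation
  selects. By contractivity, membership is a greatest fixed point around a least fixed point that
  counts the unions passed before the next constructor. Give \<open>v \<in> t1\<close> the weight of all unions at
  its root or, for an object type, at the roots of all its fields together. Each selected
  \<open>\<or>L\<close> or \<open>distr\<close> lowers this finite weight, and \<open>\<or>R1\<close>, \<open>\<or>R2\<close> cannot be repeated forever. So
  finitely many \<open>\<or>R\<close> steps lead to \<open>int\<close> or \<open>obj\<close>, where coinduction takes over.\<close>

section \<open>Contractive derivations\<close>

definition derivable :: "('r \<Rightarrow> 'j list \<Rightarrow> 'j \<Rightarrow> bool) \<Rightarrow> 'r set \<Rightarrow> 'j \<Rightarrow> bool" where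
  "derivable R L j \<longleftrightarrow> (\<exists>d. derivation R d \<and> contractive L d \<and> concl d = j)"

text \<open>A finite path to a node labelled outside \<open>L\<close> witnesses that
  \<open>labels d\<close> is not contained in \<open>L\<close>. The inductive form makes
  contractivity usable: one can induct along such a path.\<close>

inductive reaches_outside :: "'r set \<Rightarrow> ('j, 'r) deriv \<Rightarrow> bool" for L where
  here: "label d \<notin> L \<Longrightarrow> reaches_outside L d"
| child: "d' \<in> set (children d) \<Longrightarrow> reaches_outside L d' \<Longrightarrow> reaches_outside L d"

lemma label_in_labels: "label d \<in> labels d"
  by (cases d) simp

lemma labels_child: "d' \<in> set (children d) \<Longrightarrow> labels d' \<subseteq> labels d"
  by (cases d) auto

lemma reaches_outside_iff: "reaches_outside L d \<longleftrightarrow> \<not> labels d \<subseteq> L"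
proof
  assume "reaches_outside L d"
  then show "\<not> labels d \<subseteq> L"
    by induction (use label_in_labels labels_child in blast)+
next
  have "r \<notin> L \<longrightarrow> reaches_outside L d" if "r \<in> labels d" for r
    using that
    by (induction rule: deriv.set_induct(2))
      (auto intro: reaches_outside.intros)
  then show "\<not> labels d \<subseteq> L \<Longrightarrow> reaches_outside L d"
    by blast
qed

text \<open>By contractivity, a finite path leads from the root out of \<open>L\<close>, and the
  induction runs along it. Hence the hypothesis \<open>Q\<close> is available only for one premise,
  the next on the path, and only while the label lies in \<open>L\<close>; every premise is still
  derivable.\<close>

lemma derivable_induct [consumes 1, case_names step]:
  assumes "derivable R L j"
    and step: "\<And>r ps j. \<lbrakk>R r ps j; \<And>p. p \<in> set ps \<Longrightarrow> derivable R L p;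
      r \<in> L \<Longrightarrow> \<exists>p\<in>set ps. Q p\<rbrakk> \<Longrightarrow> Q j"
  shows "Q j"
proof -
  obtain d where d: "derivation R d" "contractive L d" and j: "concl d = j"
    using assms(1) by (auto simp: derivable_def)
  then have "reaches_outside L d"
    by (auto simp: contractive_def reaches_outside_iff intro: subderiv.refl)
  have sub: "derivation R e \<and> contractive L e"
    if "derivation R d" "contractive L d" "e \<in> set (children d)" for d e
    using that by (auto simp: derivation_def contractive_def intro: subderiv.child)
  from \<open>reaches_outside L d\<close> have "Q (concl d)"
    using d
  proof induction
    case (here d)
    show ?case
    proof (rule step)
      show "R (label d) (map concl (children d)) (concl d)"
        using here by (auto simp: derivation_def intro: subderiv.refl)
      show "derivable R L p" if "p \<in> set (map concl (children d))" for p
        using that sub[OF here.prems] unfolding derivable_def by auto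
    qed (use here in blast)
  next
    case (child d' d)
    note sub = sub[OF child.prems]
    show ?case
    proof (rule step)
      show "R (label d) (map concl (children d)) (concl d)"
        using child.prems by (auto simp: derivation_def intro: subderiv.refl)
      show "derivable R L p" if "p \<in> set (map concl (children d))" for p
        using that sub unfolding derivable_def by auto
      show "\<exists>p\<in>set (map concl (children d)). Q p"
        using child.IH child.hyps(1) sub by auto
    qed
  qed
  then show ?thesis
    by (simp add: j)
qed

primcorec build_deriv :: "('j \<Rightarrow> 'r) \<Rightarrow> ('j \<Rightarrow> 'j list) \<Rightarrow> 'j \<Rightarrow> ('j, 'r) deriv" where
  "build_deriv lab prems j = Node j (lab j) (map (build_deriv lab prems) (prems j))"

text \<open>The measure certifies contractivity: at a node labelled in \<open>L\<close> it drops
  along some premise, so following such premises leaves \<open>L\<close> after finitely many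
  steps.\<close>

lemma derivable_coinduct:
  fixes m :: "'j \<Rightarrow> nat"
  assumes step: "\<And>j. P j \<Longrightarrow> \<exists>r ps. R r ps j \<and> (\<forall>p\<in>set ps. P p) \<and>
      (r \<in> L \<longrightarrow> (\<exists>p\<in>set ps. m p < m j))"
    and "P j"
  shows "derivable R L j"
proof -
  \<comment> \<open>The rule instance is chosen once per judgment, so that every subtree of the tree
    built from these choices is determined by its root judgment.\<close>
  have "\<forall>j\<in>Collect P. \<exists>x. R (fst x) (snd x) j \<and> (\<forall>p\<in>set (snd x). P p) \<and>
      (fst x \<in> L \<longrightarrow> (\<exists>p\<in>set (snd x). m p < m j))"
    using step by simp
  then obtain g where g: "\<forall>j\<in>Collect P. R (fst (g j)) (snd (g j)) j \<and>
      (\<forall>p\<in>set (snd (g j)). P p) \<and> (fst (g j) \<in> L \<longrightarrow> (\<exists>p\<in>set (snd (g j)). m p < m j))"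
    by (rule bchoice[THEN exE])
  define lab prems where "lab j = fst (g j)" and "prems j = snd (g j)" for j
  have R: "R (lab j) (prems j) j"
    and P: "p \<in> set (prems j) \<Longrightarrow> P p"
    and m_less: "lab j \<in> L \<Longrightarrow> \<exists>p\<in>set (prems j). m p < m j" if "P j" for j p
    using g that by (auto simp: lab_def prems_def)
  let ?b = "build_deriv lab prems"
  have sub: "\<exists>i. P i \<and> e = ?b i" if "subderiv e d" "d = ?b j" "P j" for e d j
    using that by (induction arbitrary: j) (auto dest: P)
  have outside: "reaches_outside L (?b i)" if "P i" for i
    using that
  proof (induction "m i" arbitrary: i rule: less_induct)
    case (less i)
    show ?case
    proof (cases "lab i \<in> L")
      case True
      then obtain p where p: "p \<in> set (prems i)" "m p < m i"
        using m_less[OF less.prems] by blast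
      then have "reaches_outside L (?b p)"
        using less P by blast
      with p show ?thesis
        by (auto intro: reaches_outside.child[of "?b p"])
    qed (simp add: reaches_outside.here)
  qed
  have "derivation R (?b j)"
    unfolding derivation_def using sub[OF _ HOL.refl \<open>P j\<close>] R
    by (fastforce simp: comp_def)
  moreover have "contractive L (?b j)"
    unfolding contractive_def using sub[OF _ HOL.refl \<open>P j\<close>] outside
    by (metis reaches_outside_iff)
  ultimately show ?thesis
    unfolding derivable_def by (intro exI[of _ "?b j"]) simp
qed

section \<open>Membership\<close>

text \<open>The inner least fixed point. \<open>X\<close> stays open because it is the relation at
  the fields, over which the outer greatest fixed point is taken. The index is explicit because its
  minimum later serves as the measure for contractivity.\<close>

inductive mem_step ::
  "(('c, 'f) val \<Rightarrow> ('c, 'f) ty \<Rightarrow> bool) \<Rightarrow> nat \<Rightarrow> ('c, 'f) val \<Rightarrow> ('c, 'f) ty \<Rightarrow> bool" for X where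
  int: "mem_step X 0 (VInt i) TInt"
| orL: "mem_step X n v t1 \<Longrightarrow> mem_step X (Suc n) v (TOr t1 t2)"
| orR: "mem_step X n v t2 \<Longrightarrow> mem_step X (Suc n) v (TOr t1 t2)"
| obj: "\<lbrakk>fmdom' \<sigma> \<subseteq> fmdom' \<rho>;
    \<And>f. f \<in> fmdom' \<sigma> \<Longrightarrow> X (the (fmlookup \<rho> f)) (the (fmlookup \<sigma> f))\<rbrakk> \<Longrightarrow>
    mem_step X 0 (VObj c \<rho>) (TObj c \<sigma>)"

lemma has_type_iff: "has_type v t \<longleftrightarrow> derivable mem_rule {MemOrL, MemOrR} (v, t)"
  by (simp add: has_type_def derivable_def)

lemma mem_step_if_has_type:
  assumes "has_type v t"
  shows "\<exists>n. mem_step has_type n v t"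
proof -
  have "case j of (v, t) \<Rightarrow> \<exists>n. mem_step has_type n v t"
    if "derivable mem_rule {MemOrL, MemOrR} j" for j :: "('a, 'b) val \<times> ('a, 'b) ty"
    using that
  proof (induction rule: derivable_induct)
    case (step r ps j)
    from step(1) show ?case
    proof cases
      case (obj fs \<sigma> \<rho> c)
      then have "has_type (the (fmlookup \<rho> f)) (the (fmlookup \<sigma> f))" if "f \<in> fmdom' \<sigma>" for f
        using that step(2) by (auto simp: has_type_iff)
      then show ?thesis
        using obj by (auto intro: mem_step.obj)
    qed (use step(3) in \<open>auto intro: mem_step.intros\<close>)
  qed
  then show ?thesis
    using assms by (auto simp: has_type_iff)
qed

lemma has_type_coinduct:
  assumes P: "\<And>v t. P v t \<Longrightarrow> \<exists>n. mem_step P n v t"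
    and "mem_step P n v t"
  shows "has_type v t"
proof -
  \<comment> \<open>\<open>P\<close> need not hold in the middle of a chain of unions, so the
    invariant \<open>Q\<close> also admits those judgments. Taking the least index makes the measure
    drop at each union step: the premise has an index one smaller, which bounds its minimum.\<close>
  define Q where "Q = (\<lambda>(v, t). \<exists>n. mem_step P n v t)"
  define m where "m = (\<lambda>(v, t). LEAST n. mem_step P n v t)"
  have m_le: "m (w, u) \<le> n" if "mem_step P n w u" for n w u
    unfolding m_def using that by (auto intro: Least_le)
  have "derivable mem_rule {MemOrL, MemOrR} (v, t)"
  proof (rule derivable_coinduct[where P = Q and m = m])
    fix j assume "Q j"
    obtain w u where j: "j = (w, u)"
      by fastforce
    with \<open>Q j\<close> have "mem_step P (m (w, u)) w u"
      unfolding Q_def m_def by (auto intro: LeastI)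
    then show "\<exists>r ps. mem_rule r ps j \<and> (\<forall>p\<in>set ps. Q p) \<and>
        (r \<in> {MemOrL, MemOrR} \<longrightarrow> (\<exists>p\<in>set ps. m p < m j))"
    proof cases
      case (int i)
      then show ?thesis
        unfolding j by (intro exI[of _ MemInt] exI[of _ "[]"]) (auto intro: mem_rule.int)
    next
      case (orL n u1 u2)
      then show ?thesis
        unfolding j using m_le[OF orL(3)]
        by (intro exI[of _ MemOrL] exI[of _ "[(w, u1)]"]) (auto simp: Q_def intro: mem_rule.orL)
    next
      case (orR n u2 u1)
      then show ?thesis
        unfolding j using m_le[OF orR(3)]
        by (intro exI[of _ MemOrR] exI[of _ "[(w, u2)]"]) (auto simp: Q_def intro: mem_rule.orR)
    next
      case (obj \<sigma> \<rho> c)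
      obtain fs where fs: "set fs = fmdom' \<sigma>" "distinct fs"
        using finite_distinct_list[OF finite_fmdom'] by metis
      let ?ps = "map (\<lambda>f. (the (fmlookup \<rho> f), the (fmlookup \<sigma> f))) fs"
      have "mem_rule MemObj ?ps j"
        unfolding j obj using fs obj by (intro mem_rule.obj)
      moreover have "\<forall>p\<in>set ?ps. Q p"
        using fs obj P by (auto simp: Q_def)
      ultimately show ?thesis
        by blast
    qed
  qed (use assms in \<open>auto simp: Q_def\<close>)
  then show ?thesis
    by (simp add: has_type_iff)
qed

text \<open>\<open>distr\<close> splits a union inside a field while the root stays an object, where
  the index of \<open>mem_step\<close> is always 0. Summing the indices of the fields makes such a
  step visible. This is a relation and not a function of value and type, since the count depends on
  which disjuncts the membership selects.\<close>

inductive mem_weight :: "nat \<Rightarrow> ('c, 'f) val \<Rightarrow> ('c, 'f) ty \<Rightarrow> bool" where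
  int: "mem_weight 0 (VInt i) TInt"
| orL: "mem_weight n v t1 \<Longrightarrow> mem_weight (Suc n) v (TOr t1 t2)"
| orR: "mem_weight n v t2 \<Longrightarrow> mem_weight (Suc n) v (TOr t1 t2)"
| obj: "\<lbrakk>fmdom' \<sigma> \<subseteq> fmdom' \<rho>;
    \<And>f. f \<in> fmdom' \<sigma> \<Longrightarrow> mem_step has_type (k f) (the (fmlookup \<rho> f)) (the (fmlookup \<sigma> f));
    n = sum k (fmdom' \<sigma>)\<rbrakk> \<Longrightarrow>
    mem_weight n (VObj c \<rho>) (TObj c \<sigma>)"

lemma mem_weight_if_has_type:
  assumes "has_type v t"
  shows "\<exists>n. mem_weight n v t"
proof -
  obtain n where "mem_step has_type n v t"
    using mem_step_if_has_type[OF assms] by blast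
  then show ?thesis
  proof induction
    case (obj \<sigma> \<rho> c)
    have "\<forall>f\<in>fmdom' \<sigma>. \<exists>n. mem_step has_type n (the (fmlookup \<rho> f)) (the (fmlookup \<sigma> f))"
      using obj(2) mem_step_if_has_type by blast
    then obtain k where
      "\<forall>f\<in>fmdom' \<sigma>. mem_step has_type (k f) (the (fmlookup \<rho> f)) (the (fmlookup \<sigma> f))"
      by (rule bchoice[THEN exE])
    with obj(1) show ?case
      by (blast intro: mem_weight.obj)
  qed (auto intro: mem_weight.intros)
qed

inductive_cases mem_step_TOrE: "mem_step X n v (TOr t1 t2)"
inductive_cases mem_weight_TIntE: "mem_weight n v TInt"
inductive_cases mem_weight_TOrE: "mem_weight n v (TOr t1 t2)"

lemma mem_weight_TObjE:
  assumes "mem_weight n v (TObj c \<sigma>)"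
  obtains \<rho> k where "v = VObj c \<rho>" and "fmdom' \<sigma> \<subseteq> fmdom' \<rho>"
    and "\<forall>f\<in>fmdom' \<sigma>. mem_step has_type (k f) (the (fmlookup \<rho> f)) (the (fmlookup \<sigma> f))"
    and "n = sum k (fmdom' \<sigma>)"
  using assms by cases blast

text \<open>The type of field \<open>f\<close> is a union, so its index is a successor and its
  membership passes to one disjunct \<open>u\<close>. Replacing the union by \<open>u\<close> lowers
  this summand and keeps the others.\<close>

lemma mem_weight_distr:
  assumes "mem_weight n v (TObj c (fmupd f (TOr u1 u2) \<sigma>))" and "f \<notin> fmdom' \<sigma>"
  shows "\<exists>n'<n. \<exists>u\<in>{u1, u2}. mem_weight n' v (TObj c (fmupd f u \<sigma>))"
proof -
  from assms(1) obtain \<rho> k where v: "v = VObj c \<rho>"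
    and dom: "fmdom' (fmupd f (TOr u1 u2) \<sigma>) \<subseteq> fmdom' \<rho>"
    and k: "\<forall>g\<in>fmdom' (fmupd f (TOr u1 u2) \<sigma>).
      mem_step has_type (k g) (the (fmlookup \<rho> g)) (the (fmlookup (fmupd f (TOr u1 u2) \<sigma>) g))"
    and n: "n = sum k (fmdom' (fmupd f (TOr u1 u2) \<sigma>))"
    by (blast elim: mem_weight_TObjE)
  have "mem_step has_type (k f) (the (fmlookup \<rho> f)) (TOr u1 u2)"
    using k by simp
  then obtain k' u where k': "k f = Suc k'" "u \<in> {u1, u2}"
      "mem_step has_type k' (the (fmlookup \<rho> f)) u"
    by (auto elim!: mem_step_TOrE)
  have "mem_weight (sum (k(f := k')) (insert f (fmdom' \<sigma>))) v (TObj c (fmupd f u \<sigma>))"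
    unfolding v
  proof (rule mem_weight.obj[where k = "k(f := k')"])
    fix g assume "g \<in> fmdom' (fmupd f u \<sigma>)"
    then show "mem_step has_type ((k(f := k')) g) (the (fmlookup \<rho> g))
        (the (fmlookup (fmupd f u \<sigma>) g))"
      using k k'(3) by (auto split: if_splits)
  qed (use dom in auto)
  moreover have "sum (k(f := k')) (insert f (fmdom' \<sigma>)) < n"
    unfolding n fmdom'_fmupd by (rule sum_strict_mono_ex1) (auto simp: k'(1))
  ultimately show ?thesis
    using k'(2) by blast
qed

section \<open>Soundness of subtyping\<close>

lemma subtype_iff: "subtype t1 t2 \<longleftrightarrow> derivable sub_rule {SubOrR1, SubOrR2} (t1, t2)"
  by (simp add: subtype_def derivable_def)

text \<open>A nested induction for a fixed value. For \<open>SubOrL\<close> and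
  \<open>SubDistr\<close> the selected premise has smaller weight, so the outer hypothesis applies.
  \<open>SubOrR1\<close> and \<open>SubOrR2\<close> keep \<open>t1\<close> and the weight, and the
  inner induction along the contractive derivation absorbs them. \<open>SubInt\<close> and
  \<open>SubObj\<close> end the chain with index 0.\<close>

lemma mem_step_if_subtype:
  fixes t1 t2 :: "('c, 'f) ty"
  assumes "mem_weight n v t1" and "subtype t1 t2"
  shows "\<exists>m. mem_step (\<lambda>v t. \<exists>t0. has_type v t0 \<and> subtype t0 t) m v t2"
  using assms
proof (induction n arbitrary: t1 t2 rule: less_induct)
  case (less n)
  let ?P = "\<lambda>v t. \<exists>t0. has_type v t0 \<and> subtype t0 t"
  note weight_IH = less.IH
  have "case j of (t1, t2) \<Rightarrow> mem_weight n v t1 \<longrightarrow> (\<exists>m. mem_step ?P m v t2)"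
    if "derivable sub_rule {SubOrR1, SubOrR2} j" for j :: "('c, 'f) ty \<times> ('c, 'f) ty"
    using that
  proof (induction rule: derivable_induct)
    case (step r ps j)
    from step(1) show ?case
    proof cases
      case int
      then show ?thesis
        by (auto elim!: mem_weight_TIntE intro: mem_step.int)
    next
      case (orL u1 t u2)
      then have "subtype u1 t" "subtype u2 t"
        using step(2) by (auto simp: subtype_iff)
      then show ?thesis
        using orL weight_IH by (auto elim!: mem_weight_TOrE)
    next
      case (obj fs \<sigma>' \<sigma> c)
      have "\<exists>m. mem_step ?P m v (TObj c \<sigma>')" if "mem_weight n v (TObj c \<sigma>)"
      proof -
        from that obtain \<rho> k where v: "v = VObj c \<rho>" and dom: "fmdom' \<sigma> \<subseteq> fmdom' \<rho>"
          and k: "\<forall>f\<in>fmdom' \<sigma>.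
            mem_step has_type (k f) (the (fmlookup \<rho> f)) (the (fmlookup \<sigma> f))"
          by (blast elim: mem_weight_TObjE)
        have "?P (the (fmlookup \<rho> f)) (the (fmlookup \<sigma>' f))" if f: "f \<in> fmdom' \<sigma>'" for f
        proof (intro exI conjI)
          have "mem_step has_type (k f) (the (fmlookup \<rho> f)) (the (fmlookup \<sigma> f))"
            using k f obj by blast
          \<comment> \<open>The intermediate type \<open>t0\<close> is the type of the field in
            \<open>\<sigma>\<close>. Since \<open>has_type\<close> unfolds into
            \<open>mem_step has_type\<close>, it can be its own coinduction invariant, which folds
            the layer back.\<close>
          then show "has_type (the (fmlookup \<rho> f)) (the (fmlookup \<sigma> f))"
            using has_type_coinduct[of has_type] mem_step_if_has_type by blast
          show "subtype (the (fmlookup \<sigma> f)) (the (fmlookup \<sigma>' f))"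
            using step(2) f obj by (auto simp: subtype_iff)
        qed
        moreover have "fmdom' \<sigma>' \<subseteq> fmdom' \<rho>"
          using dom obj by blast
        ultimately show ?thesis
          unfolding v by (intro exI[of _ 0] mem_step.obj)
      qed
      then show ?thesis
        using obj by simp
    next
      case (distr f \<sigma> c u1 t u2)
      then have "subtype (TObj c (fmupd f u \<sigma>)) t" if "u \<in> {u1, u2}" for u
        using that step(2) by (auto simp: subtype_iff)
      moreover have "\<exists>n'<n. \<exists>u\<in>{u1, u2}. mem_weight n' v (TObj c (fmupd f u \<sigma>))"
        if "mem_weight n v (TObj c (fmupd f (TOr u1 u2) \<sigma>))"
        using that distr by (intro mem_weight_distr)
      ultimately show ?thesis
        unfolding distr(3) using weight_IH by blast
    qed (use step(3) in \<open>auto intro: mem_step.intros\<close>)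
  qed
  then show ?case
    using less.prems by (auto simp: subtype_iff)
qed

theorem theorem4p1:
  fixes t1 t2 :: "('c, 'f) ty"
  assumes "subtype t1 t2"
  shows "interp t1 \<subseteq> interp t2"
proof -
  \<comment> \<open>The invariant forgets the subtype \<open>t0\<close>, because each descent into a
    field replaces it by the type of that field.\<close>
  let ?P = "\<lambda>v t. \<exists>t0. has_type v t0 \<and> subtype t0 t"
  have step: "\<exists>m. mem_step ?P m v t" if "?P v t" for v and t :: "('c, 'f) ty"
    using that mem_weight_if_has_type mem_step_if_subtype by blast
  have "has_type v t2" if "has_type v t1" for v
    using step[of v t2] assms that has_type_coinduct[of ?P, OF step] by blast
  then show ?thesis
    by (auto simp: interp_def)
qed

end
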